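(* Let $h(t)=t^\top Gt+2w^\top t$ and $f(t)=t^\top\widetilde Gt+2w^\top t$ for $t\in\mathbb{R}^{nM}$. The problem (SQP1) $$\min_{t\in\mathbb{R}^{nM}} h(t)\quad\text{s.t. } \boldsymbol{e}^\top\bar t_j=1,\ j=1,\ldots,n,\quad t\geqslant 0,\quad \|t\|_0\leqslant n,$$ is equivalent to the problem (SQP2) $$\min_{t\in\mathbb{R}^{nM}} f(t)\quad\text{s.t. } \boldsymbol{e}^\top\bar t_j=1,\ j=1,\ldots,n,\quad t\geqslant 0,\quad \|t\|_0\leqslant n,$$ i.e., they have the same feasible set and the same global minimizers.
   Context: $m,n\geqslant1$ and $M\geqslant 2$ are integers, $H\in\mathbb{C}^{m\times n}$, $r\in\mathbb{C}^m$; $(\cdot)^\dagger$ is the conjugate transpose. $Q=H^\dagger H$, $c=-H^\dagger r$. $\widehat Q=\begin{bmatrix}\mathrm{Re}(Q)&-\mathrm{Im}(Q)\\ \mathrm{Im}(Q)&\mathrm{Re}(Q)\end{bmatrix}\in\mathbb{R}^{2n\times 2n}$, $\hat c=\begin{bmatrix}\mathrm{Re}(c)\\ \mathrm{Im}(c)\end{bmatrix}\in\mathbb{R}^{2n}$. $\theta_k=2(k-1)\pi/M$ for $k=1,\ldots,M$; $\alpha=(\cos\theta_1,\ldots,\cos\theta_M)^\top$, $\beta=(\sin\theta_1,\ldots,\sin\theta_M)^\top\in\mathbb{R}^M$. $A=I\otimes\alpha^\top$, $B=I\otimes\beta^\top\in\mathbb{R}^{n\times nM}$ ($I$ the $n\times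 n$ identity, $\otimes$ the Kronecker product), $P=\begin{bmatrix}A\\ B\end{bmatrix}\in\mathbb{R}^{2n\times nM}$, $G=P^\top\widehat QP\in\mathbb{R}^{nM\times nM}$, $w=P^\top\hat c\in\mathbb{R}^{nM}$. $G$ is partitioned into $n\times n$ blocks $S_{jk}\in\mathbb{R}^{M\times M}$; $\widetilde D=\mathrm{Diag}(S_{11},\ldots,S_{nn})$ is the block-diagonal matrix of the diagonal blocks, and $\widetilde G=G-\widetilde D$. A vector $t\in\mathbb{R}^{nM}$ is partitioned as $t=(\bar t_1^\top,\ldots,\bar t_n^\top)^\top$ with blocks $\bar t_j\in\mathbb{R}^M$. $\boldsymbol{e}$ is the all-ones vector, $\|t\|_0$ is the number of nonzero entries of $t$, and $t\geqslant0$ is entrywise. *)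

theory Defs
  imports Complex_Main "Jordan_Normal_Form.Schur_Decomposition"
begin

text \<open>
  All vector, matrix and block indices are 0-based, whereas the mathematics counts from 1: block
  \<open>j\<close> of a vector of dimension \<open>n * M\<close> occupies the positions \<open>j * M, \<dots>, j * M + M - 1\<close>.
\<close>

subsection \<open>The data of the problem\<close>

definition quad_mat :: "complex mat \<Rightarrow> complex mat" where
  "quad_mat H = mat_adjoint H * H"

definition lin_vec :: "complex mat \<Rightarrow> complex vec \<Rightarrow> complex vec" where
  "lin_vec H r = - (mat_adjoint H *\<^sub>v r)"

definition quad_mat_real :: "complex mat \<Rightarrow> real mat" where
  "quad_mat_real H =
     four_block_mat (map_mat Re (quad_mat H)) (- map_mat Im (quad_mat H))
                    (map_mat Im (quad_mat H)) (map_mat Re (quad_mat H))"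

definition lin_vec_real :: "complex mat \<Rightarrow> complex vec \<Rightarrow> real vec" where
  "lin_vec_real H r = map_vec Re (lin_vec H r) @\<^sub>v map_vec Im (lin_vec H r)"

text \<open>Here \<open>k\<close> is the 1-based index, \<open>1 \<le> k \<le> M\<close>.\<close>

definition phase :: "nat \<Rightarrow> nat \<Rightarrow> real" where
  "phase M k = 2 * (real k - 1) * pi / real M"

definition cos_vec :: "nat \<Rightarrow> real vec" where
  "cos_vec M = vec M (\<lambda>i. cos (phase M (i + 1)))"

definition sin_vec :: "nat \<Rightarrow> real vec" where
  "sin_vec M = vec M (\<lambda>i. sin (phase M (i + 1)))"

definition kronecker :: "'a :: times mat \<Rightarrow> 'a mat \<Rightarrow> 'a mat" where
  "kronecker X Y = mat (dim_row X * dim_row Y) (dim_col X * dim_col Y)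
     (\<lambda>(i, j). X $$ (i div dim_row Y, j div dim_col Y) * Y $$ (i mod dim_row Y, j mod dim_col Y))"

definition A_mat :: "nat \<Rightarrow> nat \<Rightarrow> real mat" where
  "A_mat n M = kronecker (1\<^sub>m n) (mat_of_row (cos_vec M))"

definition B_mat :: "nat \<Rightarrow> nat \<Rightarrow> real mat" where
  "B_mat n M = kronecker (1\<^sub>m n) (mat_of_row (sin_vec M))"

definition P_mat :: "nat \<Rightarrow> nat \<Rightarrow> real mat" where
  "P_mat n M = A_mat n M @\<^sub>r B_mat n M"

definition G_mat :: "nat \<Rightarrow> nat \<Rightarrow> complex mat \<Rightarrow> real mat" where
  "G_mat n M H = (P_mat n M)\<^sup>T * quad_mat_real H * P_mat n M"

definition w_vec :: "nat \<Rightarrow> nat \<Rightarrow> complex mat \<Rightarrow> complex vec \<Rightarrow> real vec" where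
  "w_vec n M H r = (P_mat n M)\<^sup>T *\<^sub>v lin_vec_real H r"

definition mat_block :: "nat \<Rightarrow> 'a mat \<Rightarrow> nat \<Rightarrow> nat \<Rightarrow> 'a mat" where
  "mat_block M X j k = mat M M (\<lambda>(a, b). X $$ (j * M + a, k * M + b))"

definition D_tilde :: "nat \<Rightarrow> nat \<Rightarrow> complex mat \<Rightarrow> real mat" where
  "D_tilde n M H = diag_block_mat (map (\<lambda>j. mat_block M (G_mat n M H) j j) [0..<n])"

definition G_tilde :: "nat \<Rightarrow> nat \<Rightarrow> complex mat \<Rightarrow> real mat" where
  "G_tilde n M H = G_mat n M H - D_tilde n M H"

subsection \<open>The two optimization problems\<close>

definition vec_block :: "nat \<Rightarrow> 'a vec \<Rightarrow> nat \<Rightarrow> 'a vec" where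
  "vec_block M t j = vec M (\<lambda>a. t $ (j * M + a))"

definition ones_vec :: "nat \<Rightarrow> real vec" where
  "ones_vec d = vec d (\<lambda>_. 1)"

definition l0_norm :: "real vec \<Rightarrow> nat" where
  "l0_norm t = card {i. i < dim_vec t \<and> t $ i \<noteq> 0}"

record 'a min_problem =
  objective :: "'a \<Rightarrow> real"
  feasible_set :: "'a set"

definition global_minimizers :: "'a min_problem \<Rightarrow> 'a set" where
  "global_minimizers p = {t. is_arg_min (objective p) (\<lambda>s. s \<in> feasible_set p) t}"

definition equivalent_problems :: "'a min_problem \<Rightarrow> 'a min_problem \<Rightarrow> bool" where
  "equivalent_problems p q \<longleftrightarrow>
     feasible_set p = feasible_set q \<and> global_minimizers p = global_minimizers q"

definition h_fun :: "nat \<Rightarrow> nat \<Rightarrow> complex mat \<Rightarrow> complex vec \<Rightarrow> real vec \<Rightarrow> real" where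
  "h_fun n M H r t = t \<bullet> (G_mat n M H *\<^sub>v t) + 2 * (w_vec n M H r \<bullet> t)"

definition f_fun :: "nat \<Rightarrow> nat \<Rightarrow> complex mat \<Rightarrow> complex vec \<Rightarrow> real vec \<Rightarrow> real" where
  "f_fun n M H r t = t \<bullet> (G_tilde n M H *\<^sub>v t) + 2 * (w_vec n M H r \<bullet> t)"

definition SQP1 :: "nat \<Rightarrow> nat \<Rightarrow> complex mat \<Rightarrow> complex vec \<Rightarrow> real vec min_problem" where
  "SQP1 n M H r =
     \<lparr> objective = h_fun n M H r,
       feasible_set = {t \<in> carrier_vec (n * M).
         (\<forall>j<n. ones_vec M \<bullet> vec_block M t j = 1) \<and> 0\<^sub>v (n * M) \<le> t \<and> l0_norm t \<le> n} \<rparr>"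

definition SQP2 :: "nat \<Rightarrow> nat \<Rightarrow> complex mat \<Rightarrow> complex vec \<Rightarrow> real vec min_problem" where
  "SQP2 n M H r =
     \<lparr> objective = f_fun n M H r,
       feasible_set = {t \<in> carrier_vec (n * M).
         (\<forall>j<n. ones_vec M \<bullet> vec_block M t j = 1) \<and> 0\<^sub>v (n * M) \<le> t \<and> l0_norm t \<le> n} \<rparr>"

end

theory Submission
  imports Defs
begin

text \<open>
  A feasible point has at least one nonzero entry in each of its \<open>n\<close> blocks and at most \<open>n\<close> nonzero
  entries in total, so each block is a standard unit vector. On such points the quadratic form of
  the block-diagonal part sees only diagonal entries of \<open>G\<close>, and since
  \<open>cos\<^sup>2 + sin\<^sup>2 = 1\<close> these are constant on each block, equal to \<open>Re Q\<^sub>j\<^sub>j\<close>. Hence \<open>h - f\<close> is constant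
  on the feasible set.
\<close>

lemma block_index_less:
  fixes j n a M :: nat
  assumes "j < n" "a < M"
  shows "j * M + a < n * M"
proof -
  have "j * M + a < Suc j * M" using assms(2) by simp
  also have "\<dots> \<le> n * M" using assms(1) by (intro mult_le_mono1) simp
  finally show ?thesis .
qed

lemma sum_blocks:
  fixes g :: "nat \<Rightarrow> 'a :: comm_monoid_add"
  shows "(\<Sum>i<n * M. g i) = (\<Sum>j<n. \<Sum>a<M. g (j * M + a))"
proof -
  have "sum g {j * M..<j * M + M} = (\<Sum>a<M. g (j * M + a))" for j
    using sum.shift_bounds_nat_ivl[of g 0 "j * M" M]
    by (simp add: atLeast0LessThan add.commute)
  then show ?thesis by (simp add: sum.nat_group[symmetric])
qed

text \<open>With all blocks of size \<open>d\<close>, \<open>div d\<close> selects the block and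
  \<open>mod d\<close> the position inside it. Dimension and entries go through one induction, as
  reading an entry of the \<open>Cons\<close> case requires the size of the tail.\<close>

lemma diag_block_mat_uniform:
  assumes "\<forall>A \<in> set As. A \<in> carrier_mat d d"
  shows "diag_block_mat As \<in> carrier_mat (length As * d) (length As * d)"
    and "\<lbrakk>i < length As * d; l < length As * d\<rbrakk> \<Longrightarrow> diag_block_mat As $$ (i, l) =
      (if i div d = l div d then (As ! (i div d)) $$ (i mod d, l mod d) else 0)"
proof -
  have "diag_block_mat As \<in> carrier_mat (length As * d) (length As * d) \<and>
    (\<forall>i < length As * d. \<forall>l < length As * d. diag_block_mat As $$ (i, l) =
      (if i div d = l div d then (As ! (i div d)) $$ (i mod d, l mod d) else 0))"
    using assms
  proof (induction As)
    case Nil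
    then show ?case by simp
  next
    case (Cons A As)
    have A: "A \<in> carrier_mat d d" using Cons.prems by simp
    have D: "diag_block_mat As \<in> carrier_mat (length As * d) (length As * d)"
      using Cons by simp
    have idx: "diag_block_mat As $$ (i, l) =
      (if i div d = l div d then (As ! (i div d)) $$ (i mod d, l mod d) else 0)"
      if "i < length As * d" "l < length As * d" for i l
      using Cons that by simp
    have "diag_block_mat (A # As) $$ (i, l) =
      (if i div d = l div d then ((A # As) ! (i div d)) $$ (i mod d, l mod d) else 0)"
      if i: "i < length (A # As) * d" and l: "l < length (A # As) * d" for i l
    proof -
      have d: "d > 0" using i by (cases d) auto
      show ?thesis
        \<comment> \<open>Beyond the first block, subtracting \<open>d\<close> lowers the quotient
          by one and keeps the remainder, which matches the shift from \<open>A # As\<close> to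
          \<open>As\<close>.\<close>
        using i l A D d idx[of "i - d" "l - d"]
        by (auto simp: Let_def le_div_geq le_mod_geq div_eq_0_iff not_less)
    qed
    then show ?case using A D by (simp add: Let_def)
  qed
  then show "diag_block_mat As \<in> carrier_mat (length As * d) (length As * d)"
    and "\<lbrakk>i < length As * d; l < length As * d\<rbrakk> \<Longrightarrow> diag_block_mat As $$ (i, l) =
      (if i div d = l div d then (As ! (i div d)) $$ (i mod d, l mod d) else 0)"
    by auto
qed

lemma P_mat_carrier: "P_mat n M \<in> carrier_mat (n + n) (n * M)"
  unfolding P_mat_def A_mat_def B_mat_def kronecker_def cos_vec_def sin_vec_def
  by (intro carrier_append_rows) auto

text \<open>The identity factor of the Kronecker products leaves column \<open>l\<close> only a
  cosine in row \<open>l div M\<close> and a sine \<open>n\<close> rows below. A sum of two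
  conditionals lets sums over rows split; the \<open>+ 1\<close> passes to the 1-based index of
  \<open>phase\<close>.\<close>

lemma P_mat_index:
  assumes "i < n + n" "l < n * M"
  shows "P_mat n M $$ (i, l) =
    (if i = l div M then cos (phase M (l mod M + 1)) else 0) +
    (if i = n + l div M then sin (phase M (l mod M + 1)) else 0)"
proof -
  have M: "0 < M" using assms(2) by (cases M) auto
  have ld: "l div M < n" using assms(2) by (simp add: less_mult_imp_div_less)
  have A: "A_mat n M \<in> carrier_mat n (n * M)" and B: "B_mat n M \<in> carrier_mat n (n * M)"
    by (auto simp: A_mat_def B_mat_def kronecker_def cos_vec_def sin_vec_def)
  have P: "P_mat n M $$ (i, l) =
      (if i < n then A_mat n M $$ (i, l) else B_mat n M $$ (i - n, l))"
    unfolding P_mat_def append_rows_def using assms A B by simp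
  show ?thesis
    unfolding P using assms M ld
    by (auto simp: A_mat_def B_mat_def kronecker_def cos_vec_def sin_vec_def)
qed

lemma quad_mat_real_carrier:
  assumes "H \<in> carrier_mat m n"
  shows "quad_mat_real H \<in> carrier_mat (n + n) (n + n)"
proof -
  have "quad_mat H \<in> carrier_mat n n"
    using assms by (auto simp: quad_mat_def mat_adjoint_def)
  then show ?thesis unfolding quad_mat_real_def by auto
qed

lemma G_mat_carrier: "G_mat n M H \<in> carrier_mat (n * M) (n * M)"
  using P_mat_carrier[of n M] by (auto simp: G_mat_def)

text \<open>The cross terms with \<open>Im Q\<^sub>j\<^sub>j\<close> cancel by the skew symmetry of the real representation.\<close>

lemma G_mat_diag:
  assumes H: "H \<in> carrier_mat m n" and l: "l < n * M"
  shows "G_mat n M H $$ (l, l) = Re (quad_mat H $$ (l div M, l div M))"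
proof -
  define j c s where "j = l div M" and "c = cos (phase M (l mod M + 1))"
    and "s = sin (phase M (l mod M + 1))"
  let ?P = "P_mat n M" and ?Q = "quad_mat_real H"
  have j: "j < n" using l by (simp add: j_def less_mult_imp_div_less)
  have P: "?P \<in> carrier_mat (n + n) (n * M)" by (rule P_mat_carrier)
  have Q: "?Q \<in> carrier_mat (n + n) (n + n)" by (rule quad_mat_real_carrier[OF H])
  have q: "quad_mat H \<in> carrier_mat n n"
    using H by (auto simp: quad_mat_def mat_adjoint_def)
  have p: "?P $$ (i, l) = (if i = j then c else 0) + (if i = n + j then s else 0)"
    if "i < n + n" for i
    using P_mat_index[OF that l] by (simp add: j_def c_def s_def)
  have two: "(\<Sum>i<n + n. ?P $$ (i, l) * g i) = c * g j + s * g (n + j)" for g :: "nat \<Rightarrow> real"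
  proof -
    have "(\<Sum>i<n + n. ?P $$ (i, l) * g i) =
        (\<Sum>i<n + n. (if i = j then c * g i else 0) + (if i = n + j then s * g i else 0))"
      by (intro sum.cong) (auto simp: p algebra_simps)
    then show ?thesis using j by (simp add: sum.distrib)
  qed
  have "G_mat n M H $$ (l, l) = (\<Sum>a<n + n. ?P $$ (a, l) * (\<Sum>b<n + n. ?Q $$ (a, b) * ?P $$ (b, l)))"
    unfolding G_mat_def using P Q l by (simp add: scalar_prod_def atLeast0LessThan)
  \<comment> \<open>With the entry of \<open>?P\<close> in front, \<open>two\<close> collapses the
    inner sum as well as the outer one.\<close>
  also have "\<dots> = (\<Sum>a<n + n. ?P $$ (a, l) * (\<Sum>b<n + n. ?P $$ (b, l) * ?Q $$ (a, b)))"
    by (simp only: mult.commute[of "?Q $$ _"])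
  also have "\<dots> = c * (c * ?Q $$ (j, j) + s * ?Q $$ (j, n + j)) +
      s * (c * ?Q $$ (n + j, j) + s * ?Q $$ (n + j, n + j))"
    by (simp add: two)
  also have "\<dots> = (c\<^sup>2 + s\<^sup>2) * Re (quad_mat H $$ (j, j))"
    using q j by (simp add: quad_mat_real_def algebra_simps power2_eq_square)
  also have "\<dots> = Re (quad_mat H $$ (j, j))"
    by (simp add: c_def s_def)
  finally show ?thesis by (simp add: j_def)
qed

lemma D_tilde_carrier: "D_tilde n M H \<in> carrier_mat (n * M) (n * M)"
  using diag_block_mat_uniform(1)[of "map (\<lambda>j. mat_block M (G_mat n M H) j j) [0..<n]" M]
  by (simp add: D_tilde_def mat_block_def)

lemma D_tilde_index:
  assumes "i < n * M" "l < n * M"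
  shows "D_tilde n M H $$ (i, l) = (if i div M = l div M then G_mat n M H $$ (i, l) else 0)"
proof -
  have M: "0 < M" using assms(2) by (cases M) auto
  have "i div M < n" using assms(1) by (simp add: less_mult_imp_div_less)
  \<comment> \<open>This recovers the row of \<open>G_mat\<close> from which the block entry was
    copied, after \<open>i div M\<close> is rewritten to \<open>l div M\<close>.\<close>
  moreover have "l div M * M + i mod M = i" if "i div M = l div M"
    using that by (metis div_mult_mod_eq)
  ultimately show ?thesis
    using diag_block_mat_uniform(2)[of "map (\<lambda>j. mat_block M (G_mat n M H) j j) [0..<n]" M i l] assms M
    by (auto simp: D_tilde_def mat_block_def)
qed

text \<open>Choosing one nonzero position \<open>k j\<close> per block already uses up all
  \<open>n\<close> permitted nonzero entries. Every other entry therefore vanishes, and the chosen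
  one carries the whole block sum 1.\<close>

lemma sparse_blocks_unit:
  assumes t: "t \<in> carrier_vec (n * M)"
    and sums: "\<forall>j<n. ones_vec M \<bullet> vec_block M t j = 1"
    and l0: "l0_norm t \<le> n"
  obtains k where "\<And>j. j < n \<Longrightarrow> k j < M"
    and "\<And>j a. j < n \<Longrightarrow> a < M \<Longrightarrow> t $ (j * M + a) = (if a = k j then 1 else 0)"
proof -
  have bs: "(\<Sum>a<M. t $ (j * M + a)) = 1" if "j < n" for j
    using sums that by (simp add: ones_vec_def vec_block_def scalar_prod_def atLeast0LessThan)
  have "\<exists>a<M. t $ (j * M + a) \<noteq> 0" if "j < n" for j
  proof (rule ccontr)
    assume "\<not> ?thesis"
    then have "(\<Sum>a<M. t $ (j * M + a)) = 0" by (intro sum.neutral) auto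
    then show False using bs[OF that] by simp
  qed
  then obtain k where k: "\<And>j. j < n \<Longrightarrow> k j < M" "\<And>j. j < n \<Longrightarrow> t $ (j * M + k j) \<noteq> 0"
    by metis
  define S where "S = {i. i < dim_vec t \<and> t $ i \<noteq> 0}"
  define T where "T = (\<lambda>j. j * M + k j) ` {..<n}"
  have dm: "(j * M + a) div M = j" "(j * M + a) mod M = a" if "a < M" for j a
    using that by (auto simp: div_mult_self3)
  have "inj_on (\<lambda>j. j * M + k j) {..<n}"
    by (rule inj_on_inverseI[where g = "\<lambda>i. i div M"]) (rule dm(1)[OF k(1)], simp)
  then have "card T = n" by (simp add: T_def card_image)
  moreover have "finite S" by (simp add: S_def)
  moreover have "T \<subseteq> S" using k t by (auto simp: T_def S_def block_index_less)
  \<comment> \<open>The chosen positions \<open>T\<close> lie in the support \<open>S\<close>, and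
    \<open>card S\<close> is at most \<open>n = card T\<close>.\<close>
  ultimately have "T = S" using l0 by (intro card_seteq) (auto simp: l0_norm_def S_def)
  have z: "t $ (j * M + a) = 0" if "j < n" "a < M" "a \<noteq> k j" for j a
  proof (rule ccontr)
    assume "t $ (j * M + a) \<noteq> 0"
    then have "j * M + a \<in> T" using \<open>T = S\<close> that t by (auto simp: S_def block_index_less)
    then obtain j' where j': "j' < n" "j * M + a = j' * M + k j'" by (auto simp: T_def)
    then show False using dm[OF that(2), of j] dm[OF k(1)[OF j'(1)], of j'] that(3) by simp
  qed
  have o: "t $ (j * M + k j) = 1" if "j < n" for j
  proof -
    have "(\<Sum>a<M. t $ (j * M + a)) = (\<Sum>a<M. if a = k j then t $ (j * M + a) else 0)"
      by (intro sum.cong) (use that z in auto)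
    then show ?thesis using bs[OF that] k(1)[OF that] by simp
  qed
  show ?thesis by (rule that[of k]) (use k z o in auto)
qed

lemma D_tilde_quadratic_form:
  assumes H: "H \<in> carrier_mat m n" and t: "t \<in> carrier_vec (n * M)"
    and k: "\<And>j. j < n \<Longrightarrow> k j < M"
    and tk: "\<And>j a. j < n \<Longrightarrow> a < M \<Longrightarrow> t $ (j * M + a) = (if a = k j then 1 else 0)"
  shows "t \<bullet> (D_tilde n M H *\<^sub>v t) = (\<Sum>j<n. Re (quad_mat H $$ (j, j)))"
proof -
  let ?D = "D_tilde n M H" and ?G = "G_mat n M H"
  have ti: "t $ i = (if i mod M = k (i div M) then 1 else 0)" if "i < n * M" for i
  proof -
    have "0 < M" using that by (cases M) auto
    then show ?thesis
      using tk[of "i div M" "i mod M"] that by (simp add: less_mult_imp_div_less)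
  qed
  \<comment> \<open>Off the diagonal, \<open>?D\<close> vanishes if the blocks differ; within one
    block \<open>t\<close> cannot be nonzero at both positions. On the diagonal, the second factor
    \<open>t $ i\<close> is absorbed because \<open>t\<close> has entries 0 and 1.\<close>
  have term_eq: "t $ i * (?D $$ (i, l) * t $ l) = (if l = i then t $ i * ?G $$ (i, i) else 0)"
    if "i < n * M" "l < n * M" for i l
  proof -
    have "l = i" if "i div M = l div M" "i mod M = l mod M"
      using that by (metis div_mult_mod_eq)
    then show ?thesis using that by (auto simp: D_tilde_index ti)
  qed
  have "t \<bullet> (?D *\<^sub>v t) = (\<Sum>i<n * M. \<Sum>l<n * M. t $ i * (?D $$ (i, l) * t $ l))"
    using t D_tilde_carrier[of n M H]
    by (auto simp: scalar_prod_def atLeast0LessThan sum_distrib_left intro!: sum.cong)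
  also have "\<dots> = (\<Sum>i<n * M. \<Sum>l<n * M. if l = i then t $ i * ?G $$ (i, i) else 0)"
    by (intro sum.cong refl term_eq) auto
  also have "\<dots> = (\<Sum>i<n * M. t $ i * Re (quad_mat H $$ (i div M, i div M)))"
    by (simp add: G_mat_diag[OF H])
  \<comment> \<open>The summand depends on the block alone, so the choice of \<open>k\<close> drops
    out of the final value.\<close>
  also have "\<dots> = (\<Sum>j<n. \<Sum>a<M. if a = k j then Re (quad_mat H $$ (j, j)) else 0)"
    unfolding sum_blocks by (intro sum.cong) (auto simp: tk)
  also have "\<dots> = (\<Sum>j<n. Re (quad_mat H $$ (j, j)))"
    by (intro sum.cong) (auto simp: k)
  finally show ?thesis .
qed

text \<open>\<open>is_arg_min\<close> compares objective values only between feasible points, so the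
  common constant \<open>K\<close> cancels.\<close>

lemma equivalent_problems_shift:
  assumes "feasible_set p = feasible_set q"
    and "\<And>t. t \<in> feasible_set p \<Longrightarrow> objective p t = objective q t + K"
  shows "equivalent_problems p q"
  using assms by (auto simp: equivalent_problems_def global_minimizers_def is_arg_min_def)

theorem theorem2p2:
  fixes m n M :: nat and H :: "complex mat" and r :: "complex vec"
  assumes "m \<ge> 1" and "n \<ge> 1" and "M \<ge> 2"
    and "H \<in> carrier_mat m n" and "r \<in> carrier_vec m"
  shows "equivalent_problems (SQP1 n M H r) (SQP2 n M H r)"
proof (rule equivalent_problems_shift)
  show "feasible_set (SQP1 n M H r) = feasible_set (SQP2 n M H r)"
    by (simp add: SQP1_def SQP2_def)
  fix t assume "t \<in> feasible_set (SQP1 n M H r)"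
  then have t: "t \<in> carrier_vec (n * M)"
    and "\<forall>j<n. ones_vec M \<bullet> vec_block M t j = 1" "l0_norm t \<le> n"
    by (auto simp: SQP1_def)
  then obtain k where "\<And>j. j < n \<Longrightarrow> k j < M"
    and "\<And>j a. j < n \<Longrightarrow> a < M \<Longrightarrow> t $ (j * M + a) = (if a = k j then 1 else 0)"
    by (rule sparse_blocks_unit) blast
  then have D: "t \<bullet> (D_tilde n M H *\<^sub>v t) = (\<Sum>j<n. Re (quad_mat H $$ (j, j)))"
    using D_tilde_quadratic_form[OF assms(4) t] by blast
  have "G_tilde n M H *\<^sub>v t = G_mat n M H *\<^sub>v t - D_tilde n M H *\<^sub>v t"
    unfolding G_tilde_def
    by (rule minus_mult_distrib_mat_vec[OF G_mat_carrier D_tilde_carrier t])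
  then have "t \<bullet> (G_tilde n M H *\<^sub>v t) = t \<bullet> (G_mat n M H *\<^sub>v t) - t \<bullet> (D_tilde n M H *\<^sub>v t)"
    using scalar_prod_minus_distrib[OF t, of "G_mat n M H *\<^sub>v t" "D_tilde n M H *\<^sub>v t"]
      mult_mat_vec_carrier[OF G_mat_carrier t] mult_mat_vec_carrier[OF D_tilde_carrier t] by simp
  \<comment> \<open>The constant is the real part of the trace of \<open>quad_mat H\<close>, the
    value of the \<open>D_tilde\<close> form at every feasible point.\<close>
  then show "objective (SQP1 n M H r) t =
      objective (SQP2 n M H r) t + (\<Sum>j<n. Re (quad_mat H $$ (j, j)))"
    using D by (simp add: SQP1_def SQP2_def h_fun_def f_fun_def)
qed

end
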